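(* In the category $\mathbf{Cat}$ of small categories: the pullback of an initial functor along a discrete fibration is initial, and the pullback of a final functor along a discrete opfibration is final. Explicitly, for every pullback square in $\mathbf{Cat}$ with $q:Q\to Y$, $f:X\to Y$ and $p:P=X\times_Y Q\to X$ the projection: if $q$ is final and $f$ is a discrete opfibration then $p$ is final; if $q$ is initial and $f$ is a discrete fibration then $p$ is initial.
   Context: A functor $p:P\to X$ is final if for every object $x$ of $X$ the comma category $x\backslash p$ (objects: pairs $(a, x\to pa)$ with $a$ an object of $P$) is connected, i.e. its set of connected components $\pi_0(x\backslash p)$ is a one-point set. Dually, $p$ is initial if for every $x$ the comma category $p/x$ (objects: pairs $(a, pa\to x)$) is connected. A functor $f:X\to Y$ is a discrete fibration if for every object $x$ of $X$ and every arrow $y\to fx$ in $Y$ there is a unique arrow of $X$ with codomain $x$ mapped to it by $f$; it is a discrete opfibration if for every object $x$ of $X$ and every arrow $fx\to y$ in $Y$ there is a unique arrow of $X$ with domain $x$ mapped to it by $f$. Pullbacks are strict pullbacks in $\mathbf{Cat}$. *)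

theory Defs
  imports Main
begin

text \<open>A small category has a set of objects and a set of arrows, each inside an arbitrary type.
  The operations of the record are total functions; their values outside the sets of objects, of
  arrows and of composable pairs are junk. \<open>Comp C g f\<close> is \<open>g\<close> after \<open>f\<close>.\<close>

record ('o, 'a) category_data =
  Obj :: "'o set"
  Arr :: "'a set"
  Dom :: "'a \<Rightarrow> 'o"
  Cod :: "'a \<Rightarrow> 'o"
  Ident :: "'o \<Rightarrow> 'a"
  Comp :: "'a \<Rightarrow> 'a \<Rightarrow> 'a"

locale category =
  fixes C :: "('o, 'a) category_data"
  assumes Dom_in: "u \<in> Arr C \<Longrightarrow> Dom C u \<in> Obj C"
    and Cod_in: "u \<in> Arr C \<Longrightarrow> Cod C u \<in> Obj C"
    and Ident_in: "x \<in> Obj C \<Longrightarrow> Ident C x \<in> Arr C"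
    and Dom_Ident: "x \<in> Obj C \<Longrightarrow> Dom C (Ident C x) = x"
    and Cod_Ident: "x \<in> Obj C \<Longrightarrow> Cod C (Ident C x) = x"
    and Comp_in: "\<lbrakk>u \<in> Arr C; v \<in> Arr C; Cod C u = Dom C v\<rbrakk> \<Longrightarrow> Comp C v u \<in> Arr C"
    and Dom_Comp: "\<lbrakk>u \<in> Arr C; v \<in> Arr C; Cod C u = Dom C v\<rbrakk> \<Longrightarrow> Dom C (Comp C v u) = Dom C u"
    and Cod_Comp: "\<lbrakk>u \<in> Arr C; v \<in> Arr C; Cod C u = Dom C v\<rbrakk> \<Longrightarrow> Cod C (Comp C v u) = Cod C v"
    and Comp_Ident_right: "u \<in> Arr C \<Longrightarrow> Comp C u (Ident C (Dom C u)) = u"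
    and Comp_Ident_left: "u \<in> Arr C \<Longrightarrow> Comp C (Ident C (Cod C u)) u = u"
    and Comp_assoc: "\<lbrakk>u \<in> Arr C; v \<in> Arr C; w \<in> Arr C; Cod C u = Dom C v; Cod C v = Dom C w\<rbrakk>
      \<Longrightarrow> Comp C w (Comp C v u) = Comp C (Comp C w v) u"

record ('o1, 'a1, 'o2, 'a2) functor_data =
  omap :: "'o1 \<Rightarrow> 'o2"
  amap :: "'a1 \<Rightarrow> 'a2"

locale cat_functor = X: category X + Y: category Y
  for X :: "('o1, 'a1) category_data" and Y :: "('o2, 'a2) category_data" +
  fixes f :: "('o1, 'a1, 'o2, 'a2) functor_data"
  assumes omap_in: "x \<in> Obj X \<Longrightarrow> omap f x \<in> Obj Y"
    and amap_in: "u \<in> Arr X \<Longrightarrow> amap f u \<in> Arr Y"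
    and Dom_amap: "u \<in> Arr X \<Longrightarrow> Dom Y (amap f u) = omap f (Dom X u)"
    and Cod_amap: "u \<in> Arr X \<Longrightarrow> Cod Y (amap f u) = omap f (Cod X u)"
    and amap_Ident: "x \<in> Obj X \<Longrightarrow> amap f (Ident X x) = Ident Y (omap f x)"
    and amap_Comp: "\<lbrakk>u \<in> Arr X; v \<in> Arr X; Cod X u = Dom X v\<rbrakk>
      \<Longrightarrow> amap f (Comp X v u) = Comp Y (amap f v) (amap f u)"

text \<open>Equality of functors with domain \<open>X\<close>: the underlying total functions may differ outside
  the objects and arrows of \<open>X\<close>.\<close>

definition functor_eq ::
  "('o1, 'a1) category_data \<Rightarrow> ('o1, 'a1, 'o2, 'a2) functor_data
    \<Rightarrow> ('o1, 'a1, 'o2, 'a2) functor_data \<Rightarrow> bool" where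
  "functor_eq X f g \<longleftrightarrow>
    (\<forall>x \<in> Obj X. omap f x = omap g x) \<and> (\<forall>u \<in> Arr X. amap f u = amap g u)"

definition functor_id :: "('o, 'a, 'o, 'a) functor_data" where
  "functor_id = \<lparr>omap = (\<lambda>x. x), amap = (\<lambda>u. u)\<rparr>"

definition functor_comp ::
  "('o2, 'a2, 'o3, 'a3) functor_data \<Rightarrow> ('o1, 'a1, 'o2, 'a2) functor_data
    \<Rightarrow> ('o1, 'a1, 'o3, 'a3) functor_data" where
  "functor_comp g f = \<lparr>omap = (\<lambda>x. omap g (omap f x)), amap = (\<lambda>u. amap g (amap f u))\<rparr>"

definition cat_iso ::
  "('o1, 'a1) category_data \<Rightarrow> ('o2, 'a2) category_data
    \<Rightarrow> ('o1, 'a1, 'o2, 'a2) functor_data \<Rightarrow> bool" where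
  "cat_iso X Y f \<longleftrightarrow> cat_functor X Y f \<and>
    (\<exists>g. cat_functor Y X g \<and>
      functor_eq X (functor_comp g f) functor_id \<and>
      functor_eq Y (functor_comp f g) functor_id)"

definition arrow_rel :: "('o, 'a) category_data \<Rightarrow> 'o rel" where
  "arrow_rel C = {(Dom C u, Cod C u) |u. u \<in> Arr C}"

definition pi0 :: "('o, 'a) category_data \<Rightarrow> 'o set set" where
  "pi0 C = Obj C // (arrow_rel C \<union> (arrow_rel C)\<inverse>)\<^sup>*"

definition connected_cat :: "('o, 'a) category_data \<Rightarrow> bool" where
  "connected_cat C \<longleftrightarrow> is_singleton (pi0 C)"

text \<open>\<open>comma_under P X x p\<close> is the comma category with objects the pairs of an object \<open>a\<close> of \<open>P\<close>
  and an arrow from \<open>x\<close> to \<open>p a\<close>; \<open>comma_over P X p x\<close> is the one with objects the pairs of an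
  object \<open>a\<close> of \<open>P\<close> and an arrow from \<open>p a\<close> to \<open>x\<close>. An arrow is a triple of source, underlying
  arrow of \<open>P\<close>, and target.\<close>

definition comma_under ::
  "('o1, 'a1) category_data \<Rightarrow> ('o2, 'a2) category_data \<Rightarrow> 'o2
    \<Rightarrow> ('o1, 'a1, 'o2, 'a2) functor_data
    \<Rightarrow> ('o1 \<times> 'a2, ('o1 \<times> 'a2) \<times> 'a1 \<times> ('o1 \<times> 'a2)) category_data" where
  "comma_under P X x p =
    (let Ob = {(a, u). a \<in> Obj P \<and> u \<in> Arr X \<and> Dom X u = x \<and> Cod X u = omap p a} in
     \<lparr>Obj = Ob,
      Arr = {((a, u), h, (b, v)). (a, u) \<in> Ob \<and> (b, v) \<in> Ob \<and>
               h \<in> Arr P \<and> Dom P h = a \<and> Cod P h = b \<and> Comp X (amap p h) u = v},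
      Dom = (\<lambda>(s, h, t). s),
      Cod = (\<lambda>(s, h, t). t),
      Ident = (\<lambda>(a, u). ((a, u), Ident P a, (a, u))),
      Comp = (\<lambda>(s', k, t') (s, h, t). (s, Comp P k h, t'))\<rparr>)"

definition comma_over ::
  "('o1, 'a1) category_data \<Rightarrow> ('o2, 'a2) category_data
    \<Rightarrow> ('o1, 'a1, 'o2, 'a2) functor_data \<Rightarrow> 'o2
    \<Rightarrow> ('o1 \<times> 'a2, ('o1 \<times> 'a2) \<times> 'a1 \<times> ('o1 \<times> 'a2)) category_data" where
  "comma_over P X p x =
    (let Ob = {(a, u). a \<in> Obj P \<and> u \<in> Arr X \<and> Dom X u = omap p a \<and> Cod X u = x} in
     \<lparr>Obj = Ob,
      Arr = {((a, u), h, (b, v)). (a, u) \<in> Ob \<and> (b, v) \<in> Ob \<and>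
               h \<in> Arr P \<and> Dom P h = a \<and> Cod P h = b \<and> Comp X v (amap p h) = u},
      Dom = (\<lambda>(s, h, t). s),
      Cod = (\<lambda>(s, h, t). t),
      Ident = (\<lambda>(a, u). ((a, u), Ident P a, (a, u))),
      Comp = (\<lambda>(s', k, t') (s, h, t). (s, Comp P k h, t'))\<rparr>)"

definition final_functor ::
  "('o1, 'a1) category_data \<Rightarrow> ('o2, 'a2) category_data
    \<Rightarrow> ('o1, 'a1, 'o2, 'a2) functor_data \<Rightarrow> bool" where
  "final_functor P X p \<longleftrightarrow>
    cat_functor P X p \<and> (\<forall>x \<in> Obj X. connected_cat (comma_under P X x p))"

definition initial_functor ::
  "('o1, 'a1) category_data \<Rightarrow> ('o2, 'a2) category_data
    \<Rightarrow> ('o1, 'a1, 'o2, 'a2) functor_data \<Rightarrow> bool" where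
  "initial_functor P X p \<longleftrightarrow>
    cat_functor P X p \<and> (\<forall>x \<in> Obj X. connected_cat (comma_over P X p x))"

definition discrete_fibration ::
  "('o1, 'a1) category_data \<Rightarrow> ('o2, 'a2) category_data
    \<Rightarrow> ('o1, 'a1, 'o2, 'a2) functor_data \<Rightarrow> bool" where
  "discrete_fibration X Y f \<longleftrightarrow> cat_functor X Y f \<and>
    (\<forall>x \<in> Obj X. \<forall>u \<in> Arr Y. Cod Y u = omap f x \<longrightarrow>
      (\<exists>!v. v \<in> Arr X \<and> Cod X v = x \<and> amap f v = u))"

definition discrete_opfibration ::
  "('o1, 'a1) category_data \<Rightarrow> ('o2, 'a2) category_data
    \<Rightarrow> ('o1, 'a1, 'o2, 'a2) functor_data \<Rightarrow> bool" where
  "discrete_opfibration X Y f \<longleftrightarrow> cat_functor X Y f \<and>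
    (\<forall>x \<in> Obj X. \<forall>u \<in> Arr Y. Dom Y u = omap f x \<longrightarrow>
      (\<exists>!v. v \<in> Arr X \<and> Dom X v = x \<and> amap f v = u))"

definition pullback_cat ::
  "('o1, 'a1) category_data \<Rightarrow> ('o2, 'a2) category_data
    \<Rightarrow> ('o1, 'a1, 'o3, 'a3) functor_data \<Rightarrow> ('o2, 'a2, 'o3, 'a3) functor_data
    \<Rightarrow> ('o1 \<times> 'o2, 'a1 \<times> 'a2) category_data" where
  "pullback_cat X Q f q =
    \<lparr>Obj = {(x, b). x \<in> Obj X \<and> b \<in> Obj Q \<and> omap f x = omap q b},
     Arr = {(u, h). u \<in> Arr X \<and> h \<in> Arr Q \<and> amap f u = amap q h},
     Dom = (\<lambda>(u, h). (Dom X u, Dom Q h)),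
     Cod = (\<lambda>(u, h). (Cod X u, Cod Q h)),
     Ident = (\<lambda>(x, b). (Ident X x, Ident Q b)),
     Comp = (\<lambda>(v, k) (u, h). (Comp X v u, Comp Q k h))\<rparr>"

definition proj1 :: "('o1 \<times> 'o2, 'a1 \<times> 'a2, 'o1, 'a1) functor_data" where
  "proj1 = \<lparr>omap = fst, amap = fst\<rparr>"

definition proj2 :: "('o1 \<times> 'o2, 'a1 \<times> 'a2, 'o2, 'a2) functor_data" where
  "proj2 = \<lparr>omap = snd, amap = snd\<rparr>"

definition functor_pair ::
  "('o, 'a, 'o1, 'a1) functor_data \<Rightarrow> ('o, 'a, 'o2, 'a2) functor_data
    \<Rightarrow> ('o, 'a, 'o1 \<times> 'o2, 'a1 \<times> 'a2) functor_data" where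
  "functor_pair p r =
    \<lparr>omap = (\<lambda>a. (omap p a, omap r a)), amap = (\<lambda>h. (amap p h, amap r h))\<rparr>"

text \<open>\<open>pullback_square P X Q Y p r f q\<close>: the square with \<open>f \<circ> p = q \<circ> r\<close>, where
  \<open>p : P \<rightarrow> X\<close>, \<open>r : P \<rightarrow> Q\<close>, \<open>f : X \<rightarrow> Y\<close> and \<open>q : Q \<rightarrow> Y\<close>, is a pullback in \<open>Cat\<close>. A formula
  cannot quantify over test categories on all types, so instead of the universal property the
  definition asks that the comparison functor to \<open>X \<times>\<^sub>Y Q\<close> be an isomorphism of categories. The
  lemmas below show that \<open>X \<times>\<^sub>Y Q\<close> with its projections is an instance and that the definition is
  equivalent to the universal property.\<close>

definition pullback_square ::
  "('op, 'ap) category_data \<Rightarrow> ('ox, 'ax) category_data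
    \<Rightarrow> ('oq, 'aq) category_data \<Rightarrow> ('oy, 'ay) category_data
    \<Rightarrow> ('op, 'ap, 'ox, 'ax) functor_data \<Rightarrow> ('op, 'ap, 'oq, 'aq) functor_data
    \<Rightarrow> ('ox, 'ax, 'oy, 'ay) functor_data \<Rightarrow> ('oq, 'aq, 'oy, 'ay) functor_data \<Rightarrow> bool" where
  "pullback_square P X Q Y p r f q \<longleftrightarrow>
    cat_functor P X p \<and> cat_functor P Q r \<and> cat_functor X Y f \<and> cat_functor Q Y q \<and>
    functor_eq P (functor_comp f p) (functor_comp q r) \<and>
    cat_iso P (pullback_cat X Q f q) (functor_pair p r)"

definition pullback_factorization ::
  "('ot, 'at) category_data \<Rightarrow> ('op, 'ap) category_data
    \<Rightarrow> ('op, 'ap, 'ox, 'ax) functor_data \<Rightarrow> ('op, 'ap, 'oq, 'aq) functor_data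
    \<Rightarrow> ('ot, 'at, 'ox, 'ax) functor_data \<Rightarrow> ('ot, 'at, 'oq, 'aq) functor_data
    \<Rightarrow> ('ot, 'at, 'op, 'ap) functor_data \<Rightarrow> bool" where
  "pullback_factorization T P p r h k u \<longleftrightarrow> cat_functor T P u \<and>
    functor_eq T (functor_comp p u) h \<and> functor_eq T (functor_comp r u) k"

lemma cat_functor_comp:
  assumes "cat_functor X Y f" "cat_functor Y Z g"
  shows "cat_functor X Z (functor_comp g f)"
proof -
  interpret f: cat_functor X Y f by fact
  interpret g: cat_functor Y Z g by fact
  show ?thesis
    by unfold_locales
      (simp_all add: functor_comp_def f.omap_in f.amap_in f.Dom_amap f.Cod_amap f.amap_Ident
        f.amap_Comp g.omap_in g.amap_in g.Dom_amap g.Cod_amap g.amap_Ident g.amap_Comp)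
qed

lemma cat_functor_id: "category X \<Longrightarrow> cat_functor X X functor_id"
  by (simp add: cat_functor_def cat_functor_axioms_def functor_id_def)

lemma category_comma_under:
  assumes "cat_functor P X p"
  shows "category (comma_under P X x p)"
proof -
  interpret p: cat_functor P X p by fact
  show ?thesis
    by unfold_locales
      (auto simp: comma_under_def Let_def p.X.Ident_in p.X.Dom_Ident p.X.Cod_Ident p.X.Comp_in
        p.X.Dom_Comp p.X.Cod_Comp p.X.Comp_Ident_left p.X.Comp_Ident_right p.X.Comp_assoc
        p.amap_Ident p.amap_Comp p.amap_in p.Dom_amap p.Cod_amap
        simp flip: p.Y.Comp_assoc, (metis p.Y.Comp_Ident_left)+)
qed

lemma category_comma_over:
  assumes "cat_functor P X p"
  shows "category (comma_over P X p x)"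
proof -
  interpret p: cat_functor P X p by fact
  show ?thesis
    by unfold_locales
      (auto simp: comma_over_def Let_def p.X.Ident_in p.X.Dom_Ident p.X.Cod_Ident p.X.Comp_in
        p.X.Dom_Comp p.X.Cod_Comp p.X.Comp_Ident_left p.X.Comp_Ident_right p.X.Comp_assoc
        p.amap_Ident p.amap_Comp p.amap_in p.Dom_amap p.Cod_amap p.Y.Comp_assoc,
        (metis p.Y.Comp_Ident_right)+)
qed

lemma category_pullback_cat:
  assumes "cat_functor X Y f" "cat_functor Q Y q"
  shows "category (pullback_cat X Q f q)"
proof -
  interpret f: cat_functor X Y f by fact
  interpret q: cat_functor Q Y q by fact
  show ?thesis
    by unfold_locales
      (auto simp: pullback_cat_def f.X.Dom_in f.X.Cod_in f.X.Ident_in f.X.Dom_Ident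
        f.X.Cod_Ident f.X.Comp_in f.X.Dom_Comp f.X.Cod_Comp f.X.Comp_Ident_left
        f.X.Comp_Ident_right f.X.Comp_assoc q.X.Dom_in q.X.Cod_in q.X.Ident_in q.X.Dom_Ident
        q.X.Cod_Ident q.X.Comp_in q.X.Dom_Comp q.X.Cod_Comp q.X.Comp_Ident_left
        q.X.Comp_Ident_right q.X.Comp_assoc f.amap_Ident q.amap_Ident f.amap_Comp q.amap_Comp
        simp flip: f.Dom_amap f.Cod_amap q.Dom_amap q.Cod_amap)
qed

lemma cat_functor_proj:
  assumes "cat_functor X Y f" "cat_functor Q Y q"
  shows "cat_functor (pullback_cat X Q f q) X proj1"
    and "cat_functor (pullback_cat X Q f q) Q proj2"
  using assms category_pullback_cat[OF assms]
  by (auto simp: cat_functor_def cat_functor_axioms_def pullback_cat_def proj1_def proj2_def)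

lemma cat_functor_pair:
  assumes "cat_functor X Y f" "cat_functor Q Y q" "cat_functor T X h" "cat_functor T Q k"
    and "functor_eq T (functor_comp f h) (functor_comp q k)"
  shows "cat_functor T (pullback_cat X Q f q) (functor_pair h k)"
  using assms category_pullback_cat[OF assms(1,2)]
  by (auto simp: cat_functor_def cat_functor_axioms_def pullback_cat_def functor_pair_def
      functor_eq_def functor_comp_def)

lemma pullback_square_pullback_cat:
  assumes "cat_functor X Y f" "cat_functor Q Y q"
  shows "pullback_square (pullback_cat X Q f q) X Q Y proj1 proj2 f q"
proof -
  let ?P = "pullback_cat X Q f q"
  have pair: "functor_pair proj1 proj2 = functor_id"
    by (simp add: functor_pair_def proj1_def proj2_def functor_id_def)
  have id: "cat_functor ?P ?P functor_id"
    by (rule cat_functor_id[OF category_pullback_cat[OF assms]])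
  have "functor_eq ?P (functor_comp functor_id functor_id) functor_id"
    by (simp add: functor_eq_def functor_comp_def functor_id_def)
  moreover have "functor_eq ?P (functor_comp f proj1) (functor_comp q proj2)"
    by (auto simp: functor_eq_def functor_comp_def proj1_def proj2_def pullback_cat_def)
  ultimately show ?thesis
    using assms cat_functor_proj[OF assms] id
    by (auto simp: pullback_square_def cat_iso_def pair)
qed

theorem pullback_square_universal:
  assumes "pullback_square P X Q Y p r f q"
    and h: "cat_functor T X h" and k: "cat_functor T Q k"
    and hk: "functor_eq T (functor_comp f h) (functor_comp q k)"
  shows "\<exists>u. pullback_factorization T P p r h k u \<and>
    (\<forall>u'. pullback_factorization T P p r h k u' \<longrightarrow> functor_eq T u' u)"
proof -
  let ?C = "pullback_cat X Q f q" and ?s = "functor_pair p r"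
  have f: "cat_functor X Y f" and q: "cat_functor Q Y q"
    using assms(1) by (auto simp: pullback_square_def)
  obtain g where g: "cat_functor ?C P g"
      and gs: "functor_eq P (functor_comp g ?s) functor_id"
      and sg: "functor_eq ?C (functor_comp ?s g) functor_id"
    using assms(1) by (auto simp: pullback_square_def cat_iso_def)
  have t: "cat_functor T ?C (functor_pair h k)"
    by (rule cat_functor_pair[OF f q h k hk])
  let ?u = "functor_comp g (functor_pair h k)"
  have "cat_functor T P ?u"
    by (rule cat_functor_comp[OF t g])
  moreover have "functor_eq T (functor_comp p ?u) h" "functor_eq T (functor_comp r ?u) k"
    using sg cat_functor.omap_in[OF t] cat_functor.amap_in[OF t]
    by (auto simp: functor_eq_def functor_comp_def functor_pair_def functor_id_def)
  moreover have "functor_eq T u' ?u" if "pullback_factorization T P p r h k u'" for u'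
  proof -
    have u': "cat_functor T P u'"
      using that by (simp add: pullback_factorization_def)
    show ?thesis
      using that gs cat_functor.omap_in[OF u'] cat_functor.amap_in[OF u']
      by (simp add: pullback_factorization_def functor_eq_def functor_comp_def
          functor_pair_def functor_id_def) metis
  qed
  ultimately show ?thesis
    unfolding pullback_factorization_def by blast
qed

text \<open>Conversely, the universal property for the two test categories \<open>X \<times>\<^sub>Y Q\<close> and \<open>P\<close> suffices.\<close>

theorem pullback_squareI:
  assumes p: "cat_functor P X p" and r: "cat_functor P Q r"
    and f: "cat_functor X Y f" and q: "cat_functor Q Y q"
    and comm: "functor_eq P (functor_comp f p) (functor_comp q r)"
    and ex: "\<exists>u. pullback_factorization (pullback_cat X Q f q) P p r proj1 proj2 u"
    and uniq: "\<And>u u'. \<lbrakk>pullback_factorization P P p r p r u; pullback_factorization P P p r p r u'\<rbrakk>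
      \<Longrightarrow> functor_eq P u u'"
  shows "pullback_square P X Q Y p r f q"
proof -
  let ?C = "pullback_cat X Q f q" and ?s = "functor_pair p r"
  obtain g where g: "pullback_factorization ?C P p r proj1 proj2 g"
    using ex by blast
  then have gf: "cat_functor ?C P g"
    by (simp add: pullback_factorization_def)
  have s: "cat_functor P ?C ?s"
    by (rule cat_functor_pair[OF f q p r comm])
  have sg: "functor_eq ?C (functor_comp ?s g) functor_id"
    using g by (auto simp: pullback_factorization_def functor_eq_def functor_comp_def
        functor_pair_def functor_id_def proj1_def proj2_def)
  have "pullback_factorization P P p r p r (functor_comp g ?s)"
    using g cat_functor_comp[OF s gf] cat_functor.omap_in[OF s] cat_functor.amap_in[OF s]
    by (auto simp: pullback_factorization_def functor_eq_def functor_comp_def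
        functor_pair_def proj1_def proj2_def)
  moreover have "pullback_factorization P P p r p r functor_id"
    using cat_functor_id[of P] p
    by (auto simp: pullback_factorization_def functor_eq_def functor_comp_def functor_id_def
        cat_functor_def)
  ultimately have "functor_eq P (functor_comp g ?s) functor_id"
    by (rule uniq)
  then show ?thesis
    using p r f q comm s gf sg by (auto simp: pullback_square_def cat_iso_def)
qed

end

theory Submission
  imports Defs
begin

text \<open>If \<open>f\<close> is a discrete opfibration, then a pair of an object \<open>b\<close> of \<open>Q\<close> and an arrow
  \<open>f x \<rightarrow> q b\<close> lifts uniquely to a pair of an object \<open>a\<close> of \<open>P\<close> over \<open>b\<close> and an arrow
  \<open>x \<rightarrow> p a\<close>, and the arrows between such pairs lift as well. So the comma categories \<open>x \<down> p\<close>
  and \<open>f x \<down> q\<close> have the same objects and the same components. The second half of the theorem is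
  the first one applied to the opposite categories.\<close>

text \<open>The closure \<open>?R\<close> of the symmetrized arrow relation is an equivalence, so
  two classes agree iff their representatives are related. As \<open>pi0 C\<close> is the image of
  \<open>Obj C\<close> under the class map, it is a singleton iff \<open>Obj C\<close> is nonempty
  and that map is constant.\<close>

lemma connected_cat_iff:
  "connected_cat C \<longleftrightarrow> Obj C \<noteq> {} \<and>
    (\<forall>x \<in> Obj C. \<forall>y \<in> Obj C. (x, y) \<in> (arrow_rel C \<union> (arrow_rel C)\<inverse>)\<^sup>*)"
proof -
  let ?R = "(arrow_rel C \<union> (arrow_rel C)\<inverse>)\<^sup>*"
  have "sym ?R" "trans ?R"
    by (simp_all add: sym_Un_converse sym_rtrancl trans_rtrancl)
  then have "?R `` {x} = ?R `` {y} \<longleftrightarrow> (x, y) \<in> ?R" for x y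
    by (auto dest: symD transD)
  moreover have "is_singleton (h ` A) \<longleftrightarrow> A \<noteq> {} \<and> (\<forall>x \<in> A. \<forall>y \<in> A. h x = h y)"
    for h :: "'a \<Rightarrow> 'a set" and A
  proof
    assume "is_singleton (h ` A)"
    then obtain c where "h ` A = {c}" by (auto simp: is_singleton_def)
    then show "A \<noteq> {} \<and> (\<forall>x \<in> A. \<forall>y \<in> A. h x = h y)"
      by (metis imageI image_is_empty insert_not_empty singletonD)
  next
    assume A: "A \<noteq> {} \<and> (\<forall>x \<in> A. \<forall>y \<in> A. h x = h y)"
    then obtain a where "a \<in> A" by blast
    with A have "h ` A = {h a}" by blast
    then show "is_singleton (h ` A)" by (simp add: is_singleton_def)
  qed
  moreover have "pi0 C = (\<lambda>x. ?R `` {x}) ` Obj C"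
    by (auto simp: pi0_def quotient_def)
  ultimately show ?thesis
    by (simp add: connected_cat_def)
qed

text \<open>Components depend only on which objects are joined by an arrow, so \<open>G\<close> is a
  mere map of objects. If it reflects this relation, every zigzag in \<open>C\<close> pulls back to
  \<open>D\<close> edge by edge.\<close>

lemma connected_cat_bij:
  assumes C: "connected_cat C" "category C"
    and bij: "bij_betw G (Obj D) (Obj C)"
    and reflect: "\<And>s t. \<lbrakk>s \<in> Obj D; t \<in> Obj D; (G s, G t) \<in> arrow_rel C\<rbrakk>
      \<Longrightarrow> (s, t) \<in> arrow_rel D"
  shows "connected_cat D"
proof -
  let ?R = "arrow_rel C \<union> (arrow_rel C)\<inverse>" and ?S = "arrow_rel D \<union> (arrow_rel D)\<inverse>"
  have R: "c \<in> Obj C \<and> d \<in> Obj C" if "(c, d) \<in> ?R" for c d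
    using that category.Dom_in[OF C(2)] category.Cod_in[OF C(2)] by (auto simp: arrow_rel_def)
  have surj: "\<exists>s \<in> Obj D. G s = c" if "c \<in> Obj C" for c
    using that bij by (metis bij_betw_def imageE)
  have inj: "s = t" if "s \<in> Obj D" "t \<in> Obj D" "G s = G t" for s t
    using that bij by (auto simp: bij_betw_def inj_on_def)
  \<comment> \<open>Lifting of zigzags: by \<open>R\<close> each new vertex is an object of
    \<open>C\<close>, hence has a preimage under \<open>G\<close>. Injectivity later identifies the
    end of the lift with a prescribed \<open>t\<close>.\<close>
  have path: "\<exists>t \<in> Obj D. G t = c \<and> (s, t) \<in> ?S\<^sup>*" if "(G s, c) \<in> ?R\<^sup>*" "s \<in> Obj D" for s c
    using that(1)
  proof (induction rule: rtrancl_induct)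
    case base
    then show ?case using that(2) by blast
  next
    case (step c d)
    then obtain t where t: "t \<in> Obj D" "G t = c" "(s, t) \<in> ?S\<^sup>*" by blast
    obtain t' where t': "t' \<in> Obj D" "G t' = d" using surj R[OF step.hyps(2)] by blast
    have "(t, t') \<in> ?S" using step.hyps(2) t(1,2) t' reflect by auto
    with t(3) have "(s, t') \<in> ?S\<^sup>*" by (rule rtrancl_into_rtrancl)
    then show ?case using t' by blast
  qed
  have "(s, t) \<in> ?S\<^sup>*" if "s \<in> Obj D" "t \<in> Obj D" for s t
  proof -
    have "(G s, G t) \<in> ?R\<^sup>*"
      using that C(1) bij_betwE[OF bij] by (simp add: connected_cat_iff)
    then show ?thesis using path that inj by blast
  qed
  moreover have "Obj D \<noteq> {}"
    using C(1) bij by (auto simp: connected_cat_iff bij_betw_def)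
  ultimately show ?thesis
    by (simp add: connected_cat_iff)
qed

text \<open>The witness is the value at \<open>(x, b)\<close> of the inverse \<open>g\<close> of the
  comparison functor.\<close>

lemma pullback_square_lift_Obj:
  assumes "pullback_square P X Q Y p r f q"
    and "x \<in> Obj X" "b \<in> Obj Q" "omap f x = omap q b"
  obtains a where "a \<in> Obj P" "omap p a = x" "omap r a = b"
proof -
  obtain g where g: "cat_functor (pullback_cat X Q f q) P g"
    and sg: "functor_eq (pullback_cat X Q f q) (functor_comp (functor_pair p r) g) functor_id"
    using assms(1) by (auto simp: pullback_square_def cat_iso_def)
  have "(x, b) \<in> Obj (pullback_cat X Q f q)"
    using assms by (simp add: pullback_cat_def)
  then show thesis
    using that[of "omap g (x, b)"] cat_functor.omap_in[OF g] sg
    by (auto simp: functor_eq_def functor_comp_def functor_pair_def functor_id_def)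
qed

lemma pullback_square_lift_Arr:
  assumes "pullback_square P X Q Y p r f q"
    and "u \<in> Arr X" "h \<in> Arr Q" "amap f u = amap q h"
  obtains k where "k \<in> Arr P" "amap p k = u" "amap r k = h"
proof -
  obtain g where g: "cat_functor (pullback_cat X Q f q) P g"
    and sg: "functor_eq (pullback_cat X Q f q) (functor_comp (functor_pair p r) g) functor_id"
    using assms(1) by (auto simp: pullback_square_def cat_iso_def)
  have "(u, h) \<in> Arr (pullback_cat X Q f q)"
    using assms by (simp add: pullback_cat_def)
  then show thesis
    using that[of "amap g (u, h)"] cat_functor.amap_in[OF g] sg
    by (auto simp: functor_eq_def functor_comp_def functor_pair_def functor_id_def)
qed

text \<open>The comparison functor has a left inverse, so \<open>p\<close> and \<open>r\<close> are
  jointly injective on objects.\<close>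

lemma pullback_square_Obj_eqI:
  assumes "pullback_square P X Q Y p r f q"
    and "a \<in> Obj P" "b \<in> Obj P" "omap p a = omap p b" "omap r a = omap r b"
  shows "a = b"
proof -
  obtain g where "functor_eq P (functor_comp g (functor_pair p r)) functor_id"
    using assms(1) by (auto simp: pullback_square_def cat_iso_def)
  then show ?thesis
    using assms(2-) by (simp add: functor_eq_def functor_comp_def functor_pair_def functor_id_def)
      metis
qed

lemma final_functor_pullback:
  assumes sq: "pullback_square P X Q Y p r f q"
    and q: "final_functor Q Y q" and f: "discrete_opfibration X Y f"
  shows "final_functor P X p"
proof -
  interpret p: cat_functor P X p using sq by (simp add: pullback_square_def)
  interpret r: cat_functor P Q r using sq by (simp add: pullback_square_def)
  interpret f: cat_functor X Y f using sq by (simp add: pullback_square_def)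
  interpret q: cat_functor Q Y q using sq by (simp add: pullback_square_def)
  have fp: "omap f (omap p a) = omap q (omap r a)" if "a \<in> Obj P" for a
    using that sq by (simp add: pullback_square_def functor_eq_def functor_comp_def)
  have lift: "\<exists>v \<in> Arr X. Dom X v = x \<and> amap f v = u"
    if "x \<in> Obj X" "u \<in> Arr Y" "Dom Y u = omap f x" for x u
    using that f unfolding discrete_opfibration_def by metis
  \<comment> \<open>Uniqueness of lifts as a cancellation rule: \<open>v\<close> and
    \<open>w\<close> both lift \<open>amap f v\<close> from the same domain.\<close>
  have lift_unique: "v = w"
    if "v \<in> Arr X" "w \<in> Arr X" "Dom X v = Dom X w" "amap f v = amap f w" for v w
  proof -
    have "\<exists>!v'. v' \<in> Arr X \<and> Dom X v' = Dom X v \<and> amap f v' = amap f v"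
      using that(1) f p.Y.Dom_in f.amap_in f.Dom_amap by (simp add: discrete_opfibration_def)
    then show ?thesis using that by metis
  qed
  have "connected_cat (comma_under P X x p)" if x: "x \<in> Obj X" for x
  proof (rule connected_cat_bij)
    let ?C = "comma_under Q Y (omap f x) q" and ?D = "comma_under P X x p"
    \<comment> \<open>For \<open>u\<close> from \<open>x\<close> to \<open>p a\<close>, the arrow
      \<open>f u\<close> ends at \<open>f (p a) = q (r a)\<close>.\<close>
    let ?G = "\<lambda>(a, u). (omap r a, amap f u)"
    show "connected_cat ?C" "category ?C"
      using q f.omap_in[OF x] category_comma_under[OF q.cat_functor_axioms]
      by (simp_all add: final_functor_def)
    show "bij_betw ?G (Obj ?D) (Obj ?C)"
    proof (rule bij_betw_imageI)
      show "inj_on ?G (Obj ?D)"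
      proof (rule inj_onI, clarify)
        fix a u b v
        assume "(a, u) \<in> Obj ?D" "(b, v) \<in> Obj ?D"
          and eq: "omap r a = omap r b" "amap f u = amap f v"
        then have *: "a \<in> Obj P" "u \<in> Arr X" "Dom X u = x" "Cod X u = omap p a"
          "b \<in> Obj P" "v \<in> Arr X" "Dom X v = x" "Cod X v = omap p b"
          by (simp_all add: comma_under_def)
        then have "u = v" using lift_unique eq by simp
        then show "a = b \<and> u = v" using * eq pullback_square_Obj_eqI[OF sq, of a b] by simp
      qed
      show "?G ` Obj ?D = Obj ?C"
      proof (intro equalityI subsetI)
        fix c
        assume "c \<in> ?G ` Obj ?D"
        then show "c \<in> Obj ?C"
          by (auto simp: comma_under_def r.omap_in f.amap_in f.Dom_amap f.Cod_amap fp)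
      next
        fix c
        assume "c \<in> Obj ?C"
        then obtain b v where c: "c = (b, v)" "b \<in> Obj Q" "v \<in> Arr Y" "Dom Y v = omap f x"
          "Cod Y v = omap q b"
          by (auto simp: comma_under_def)
        obtain u where u: "u \<in> Arr X" "Dom X u = x" "amap f u = v"
          using lift[OF x] c by blast
        \<comment> \<open>The lift \<open>u\<close> of \<open>v\<close> ends over
          \<open>q b\<close>, so \<open>(Cod X u, b)\<close> is an object of the strict pullback and
          comes from some \<open>a\<close>.\<close>
        have "omap f (Cod X u) = omap q b"
          using u c f.Cod_amap by metis
        then obtain a where "a \<in> Obj P" "omap p a = Cod X u" "omap r a = b"
          using pullback_square_lift_Obj[OF sq, of "Cod X u" b] u c p.Y.Cod_in by metis
        then have "(a, u) \<in> Obj ?D" "?G (a, u) = c"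
          using u c by (simp_all add: comma_under_def)
        then show "c \<in> ?G ` Obj ?D" by force
      qed
    qed
    fix s t
    assume st: "s \<in> Obj ?D" "t \<in> Obj ?D" and rel: "(?G s, ?G t) \<in> arrow_rel ?C"
    obtain a u b v where s: "s = (a, u)" "a \<in> Obj P" "u \<in> Arr X" "Dom X u = x" "Cod X u = omap p a"
      and t: "t = (b, v)" "b \<in> Obj P" "v \<in> Arr X" "Dom X v = x" "Cod X v = omap p b"
      using st by (auto simp: comma_under_def)
    obtain h where h: "h \<in> Arr Q" "Dom Q h = omap r a" "Cod Q h = omap r b"
      "Comp Y (amap q h) (amap f u) = amap f v"
      using rel by (auto simp: arrow_rel_def comma_under_def s(1) t(1))
    \<comment> \<open>The arrow \<open>q h\<close> starts at \<open>q (r a) = f (p a)\<close>, so it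
      lifts to an arrow out of \<open>p a\<close>.\<close>
    obtain w where w: "w \<in> Arr X" "Dom X w = omap p a" "amap f w = amap q h"
      using lift[of "omap p a" "amap q h"] s h fp p.omap_in q.amap_in q.Dom_amap by metis
    \<comment> \<open>Both sides lift \<open>f v\<close> from \<open>x\<close>. The equation also
      fixes the codomain of \<open>w\<close>, which the lifting property alone leaves open.\<close>
    have "Comp X w u = v"
      using w s t h by (intro lift_unique) (simp_all add: p.Y.Comp_in p.Y.Dom_Comp f.amap_Comp)
    then have cod: "Cod X w = omap p b"
      using w s t p.Y.Cod_Comp by metis
    obtain k where k: "k \<in> Arr P" "amap p k = w" "amap r k = h"
      using pullback_square_lift_Arr[OF sq w(1) h(1) w(3)] .
    \<comment> \<open>The endpoints of \<open>k\<close> are known only through their images under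
      \<open>p\<close> and \<open>r\<close>; joint injectivity recovers them.\<close>
    have "Dom P k = a"
      using k w h s p.X.Dom_in p.Dom_amap r.Dom_amap by (metis pullback_square_Obj_eqI[OF sq])
    moreover have "Cod P k = b"
      using k cod h t p.X.Cod_in p.Cod_amap r.Cod_amap by (metis pullback_square_Obj_eqI[OF sq])
    ultimately have "(s, k, t) \<in> Arr ?D"
      using s t k \<open>Comp X w u = v\<close> by (simp add: comma_under_def)
    then show "(s, t) \<in> arrow_rel ?D"
      by (force simp: arrow_rel_def comma_under_def)
  qed
  then show ?thesis
    by (simp add: final_functor_def p.cat_functor_axioms)
qed

text \<open>Objects and arrows are kept as they are, so the same \<open>functor_data\<close> serve
  between the opposite categories.\<close>

definition op_cat :: "('o, 'a) category_data \<Rightarrow> ('o, 'a) category_data" where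
  "op_cat C = \<lparr>Obj = Obj C, Arr = Arr C, Dom = Cod C, Cod = Dom C, Ident = Ident C,
    Comp = (\<lambda>v u. Comp C u v)\<rparr>"

lemma op_cat_simps [simp]:
  "Obj (op_cat C) = Obj C" "Arr (op_cat C) = Arr C" "Dom (op_cat C) = Cod C"
  "Cod (op_cat C) = Dom C" "Ident (op_cat C) = Ident C" "Comp (op_cat C) v u = Comp C u v"
  by (simp_all add: op_cat_def)

lemma op_cat_op_cat [simp]: "op_cat (op_cat C) = C"
  by (simp add: op_cat_def)

lemma category_op_cat:
  assumes "category C"
  shows "category (op_cat C)"
proof -
  interpret category C by fact
  show ?thesis
    by unfold_locales (simp_all add: Dom_in Cod_in Ident_in Dom_Ident Cod_Ident Comp_in Dom_Comp
        Cod_Comp Comp_Ident_right Comp_Ident_left Comp_assoc)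
qed

lemma cat_functor_op_cat:
  assumes "cat_functor X Y f"
  shows "cat_functor (op_cat X) (op_cat Y) f"
  using assms
  by (simp add: cat_functor_def cat_functor_axioms_def category_op_cat)

lemma functor_eq_op_cat [simp]: "functor_eq (op_cat X) f g \<longleftrightarrow> functor_eq X f g"
  by (simp add: functor_eq_def)

text \<open>The structure of the strict pullback is componentwise, so this is an equality of records
  and the comparison functor can be dualized directly.\<close>

lemma pullback_cat_op_cat:
  "pullback_cat (op_cat X) (op_cat Q) f q = op_cat (pullback_cat X Q f q)"
  by (simp add: pullback_cat_def op_cat_def fun_eq_iff)

lemma pullback_square_op_cat:
  assumes "pullback_square P X Q Y p r f q"
  shows "pullback_square (op_cat P) (op_cat X) (op_cat Q) (op_cat Y) p r f q"
  using assms
  by (auto simp: pullback_square_def cat_iso_def pullback_cat_op_cat intro: cat_functor_op_cat)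

lemma discrete_opfibration_op_cat:
  assumes "discrete_fibration X Y f"
  shows "discrete_opfibration (op_cat X) (op_cat Y) f"
  using assms by (simp add: discrete_fibration_def discrete_opfibration_def cat_functor_op_cat)

text \<open>The objects coincide, but arrows are triples with source and target interchanged, so the
  arrow relations are converse to each other. Symmetrizing removes the difference.\<close>

lemma connected_comma_under_op_cat:
  "connected_cat (comma_under (op_cat P) (op_cat X) x p) \<longleftrightarrow> connected_cat (comma_over P X p x)"
proof -
  have "Obj (comma_under (op_cat P) (op_cat X) x p) = Obj (comma_over P X p x)"
    by (auto simp: comma_under_def comma_over_def)
  moreover have "arrow_rel (comma_under (op_cat P) (op_cat X) x p)
      = (arrow_rel (comma_over P X p x))\<inverse>"
    by (auto simp: arrow_rel_def comma_under_def comma_over_def)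
  ultimately show ?thesis
    by (simp add: connected_cat_def pi0_def Un_commute)
qed

lemma final_functor_op_cat:
  "final_functor (op_cat P) (op_cat X) p \<longleftrightarrow> initial_functor P X p"
  \<comment> \<open>The second instance gives the converse direction, as \<open>op_cat\<close> is an
    involution.\<close>
  using cat_functor_op_cat[of P X p] cat_functor_op_cat[of "op_cat P" "op_cat X" p]
  by (auto simp: final_functor_def initial_functor_def connected_comma_under_op_cat)

theorem proposition2p3:
  fixes P :: "('op, 'ap) category_data" and X :: "('ox, 'ax) category_data"
    and Q :: "('oq, 'aq) category_data" and Y :: "('oy, 'ay) category_data"
    and p :: "('op, 'ap, 'ox, 'ax) functor_data" and r :: "('op, 'ap, 'oq, 'aq) functor_data"
    and f :: "('ox, 'ax, 'oy, 'ay) functor_data" and q :: "('oq, 'aq, 'oy, 'ay) functor_data"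
  assumes "pullback_square P X Q Y p r f q"
  shows "(final_functor Q Y q \<and> discrete_opfibration X Y f \<longrightarrow> final_functor P X p) \<and>
    (initial_functor Q Y q \<and> discrete_fibration X Y f \<longrightarrow> initial_functor P X p)"
  using final_functor_pullback[OF assms]
    final_functor_pullback[OF pullback_square_op_cat[OF assms]]
  by (simp add: final_functor_op_cat discrete_opfibration_op_cat)

end
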